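(* Let $\{P_{m,n}(x)\}_{m,n=0}^{\infty}$ be a multiple orthogonal polynomial sequence (with respect to $r=2$ measures) which is also a multiple $\Delta$-Appell sequence. Then $\{P_{m,n}(x)\}_{m,n=0}^{\infty}$ is a sequence of multiple Charlier polynomials, i.e. there exist parameters $a_1,a_2$ such that $P_{m,n}(x)=C^{(a_1,a_2)}_{m,n}(x)$ for all $m,n\ge 0$.
   Context: $\Delta f(x)=f(x+1)-f(x)$. A family $\{P_{m,n}(x)\}_{m,n\ge0}$ of polynomials is a multiple $\Delta$-Appell sequence if $\Delta P_{m,n}(x)=mP_{m-1,n}(x)+nP_{m,n-1}(x)$ for all integers $m,n\ge 0$ (terms with coefficient $0$ are read as $0$). A multiple orthogonal polynomial sequence with respect to two measures $\mu_1,\mu_2$ on $\mathbb{R}$ (with finite moments) is a family $\{P_{m,n}(x)\}_{m,n\ge 0}$ of monic polynomials such that, for each $(m,n)$, $P_{m,n}$ has degree $m+n$ and is the unique monic polynomial of that degree satisfying $\int P_{m,n}(x)x^k\,d\mu_1(x)=0$ for $0\le k\le m-1$ and $\int P_{m,n}(x)x^k\,d\mu_2(x)=0$ for $0\le k\le n-1$. Every such sequence satisfies recurrence relations of the form $$xP_{m,n}(x)=P_{m+1,n}(x)+E_{m,n}P_{m,n}(x)+F_{m,n}P_{m-1,n}(x)+G_{m,n}P_{m,n-1}(x),$$ $$xP_{m,n}(x)=P_{m,n+1}(x)+\tilde E_{m,n}P_{m,n}(x)+\tilde F_{m,n}P_{m,n-1}(x)+\tilde G_{m,n}P_{m-1,n}(x),$$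 with real constants $E_{m,n},F_{m,n},G_{m,n},\tilde E_{m,n},\tilde F_{m,n},\tilde G_{m,n}$. The multiple Charlier polynomials are the multiple orthogonal polynomials for the discrete measures $\mu_i=\sum_{k=0}^\infty \frac{a_i^k}{k!}\delta(x-k)$, $a_i>0$, $i=1,2$; explicitly $$C_{n_1,n_2}^{(a_1,a_2)}(x)=\sum_{k=0}^{n_1}\sum_{\ell=0}^{n_2}\binom{n_1}{k}\binom{n_2}{\ell}(-a_1)^{n_1-k}(-a_2)^{n_2-\ell}\,x^{(k+\ell)},$$ where $x^{(j)}=x(x-1)\cdots(x-j+1)$ and $x^{(0)}=1$.
   Formalization: The formula is proved up to a translation common to all indices: P_{m,n}(x)=C_{m,n}^{(a1,a2)}(x−c) for some real c and a1,a2>0. With c=0 it is false: translating the Charlier family and its measures by c≠0 preserves both hypotheses but gives no Charlier family. *)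

theory Defs
  imports "HOL-Analysis.Analysis" "HOL-Computational_Algebra.Polynomial"
begin

definition fdiff :: "real poly \<Rightarrow> real poly" where
  "fdiff p = p \<circ>\<^sub>p [:1, 1:] - p"

text \<open>For index 0 the truncated subtraction is harmless: the term has coefficient 0.\<close>

definition multiple_Delta_Appell :: "(nat \<Rightarrow> nat \<Rightarrow> real poly) \<Rightarrow> bool" where
  "multiple_Delta_Appell P \<longleftrightarrow>
     (\<forall>m n. fdiff (P m n) = smult (real m) (P (m - 1) n) + smult (real n) (P m (n - 1)))"

definition borel_finite_moments :: "real measure \<Rightarrow> bool" where
  "borel_finite_moments \<mu> \<longleftrightarrow> sets \<mu> = sets borel \<and> (\<forall>k::nat. integrable \<mu> (\<lambda>x. x ^ k))"

definition monic_orthogonal ::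
  "real measure \<Rightarrow> real measure \<Rightarrow> nat \<Rightarrow> nat \<Rightarrow> real poly \<Rightarrow> bool" where
  "monic_orthogonal \<mu>\<^sub>1 \<mu>\<^sub>2 m n p \<longleftrightarrow>
     lead_coeff p = 1 \<and> degree p = m + n \<and>
     (\<forall>k<m. (LINT x|\<mu>\<^sub>1. poly p x * x ^ k) = 0) \<and>
     (\<forall>k<n. (LINT x|\<mu>\<^sub>2. poly p x * x ^ k) = 0)"

text \<open>
  No assumption that the measures have infinite support is needed:
  uniqueness at all indices forces it.
\<close>

definition multiple_OPS ::
  "real measure \<Rightarrow> real measure \<Rightarrow> (nat \<Rightarrow> nat \<Rightarrow> real poly) \<Rightarrow> bool" where
  "multiple_OPS \<mu>\<^sub>1 \<mu>\<^sub>2 P \<longleftrightarrow>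
     borel_finite_moments \<mu>\<^sub>1 \<and> borel_finite_moments \<mu>\<^sub>2 \<and>
     (\<forall>m n. monic_orthogonal \<mu>\<^sub>1 \<mu>\<^sub>2 m n (P m n) \<and>
            (\<forall>q. monic_orthogonal \<mu>\<^sub>1 \<mu>\<^sub>2 m n q \<longrightarrow> q = P m n))"

definition falling_poly :: "nat \<Rightarrow> real poly" where
  "falling_poly j = (\<Prod>i<j. [:- real i, 1:])"

text \<open>
  The properties \<open>multiple_OPS\<close> (for some pair of measures) and
  \<open>multiple_Delta_Appell\<close> are both invariant under a common translation of the
  variable, whereas the family below is not. A characterization of these
  polynomials by the two properties therefore has to allow for a translation.
\<close>

definition multiple_Charlier :: "real \<Rightarrow> real \<Rightarrow> nat \<Rightarrow> nat \<Rightarrow> real poly" where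
  "multiple_Charlier a\<^sub>1 a\<^sub>2 m n =
     (\<Sum>k\<le>m. \<Sum>l\<le>n. smult (real (m choose k) * real (n choose l) *
        (- a\<^sub>1) ^ (m - k) * (- a\<^sub>2) ^ (n - l)) (falling_poly (k + l)))"

end

theory Submission
  imports Defs
begin

text \<open>
  Normality of the index \<open>(m, n)\<close> forces \<open>P (m + 1) n - P m (n + 1)\<close> to be a multiple
  \<open>\<kappa> m n\<close> of \<open>P m n\<close>, and applying \<open>\<Delta>\<close> shows by induction that \<open>\<kappa>\<close> is constant.
  Hence the whole family is determined by \<open>\<kappa>\<close> and the edge \<open>P 0 n\<close>. The edge is a classical
  orthogonal sequence; applying \<open>\<Delta>\<close> to its three-term recurrence gives
  \<open>P 0 (n + 1) = (x - e - n) P 0 n - n f P 0 (n - 1)\<close>, which is the recurrence of the Charlier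
  polynomials with parameter \<open>f\<close>, translated by \<open>e - f\<close>. The Charlier family satisfies the
  same difference relation with \<open>\<kappa> = a\<^sub>2 - a\<^sub>1\<close>. Finally \<open>f\<close> is the quotient of the squared
  norms of \<open>P 0 1\<close> and \<open>P 0 0\<close>, hence positive, and the same applies to the other edge.
\<close>

section \<open>Recurrences of the Charlier polynomials\<close>

text \<open>This is (S - a)^n applied to the sequence \<open>g\<close>, where S is the shift of
  sequences. Keeping the position \<open>j\<close> as an argument lets such sums be nested.\<close>

definition Charlier_sum :: "(nat \<Rightarrow> real) \<Rightarrow> real \<Rightarrow> nat \<Rightarrow> nat \<Rightarrow> real" where
  "Charlier_sum g a n j = (\<Sum>l\<le>n. real (n choose l) * (- a) ^ (n - l) * g (l + j))"

lemma Charlier_sum_0 [simp]: "Charlier_sum g a 0 j = g j"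
  by (simp add: Charlier_sum_def)

lemma Charlier_sum_Suc:
  "Charlier_sum g a (Suc n) j = Charlier_sum g a n (Suc j) - a * Charlier_sum g a n j"
proof -
  define h where "h l = (- a) ^ (Suc n - l) * g (l + j)" for l
  have "Charlier_sum g a (Suc n) j = (\<Sum>l\<le>Suc n. real (Suc n choose l) * h l)"
    by (simp add: Charlier_sum_def h_def mult.assoc del: sum.atMost_Suc)
  also have "\<dots> = h 0 + (\<Sum>l\<le>n. real (n choose Suc l) * h (Suc l))
                   + (\<Sum>l\<le>n. real (n choose l) * h (Suc l))"
    by (subst sum.atMost_Suc_shift) (simp add: algebra_simps sum.distrib)
  also have "h 0 + (\<Sum>l\<le>n. real (n choose Suc l) * h (Suc l)) =
             (\<Sum>l\<le>Suc n. real (n choose l) * h l)"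
    by (subst sum.atMost_Suc_shift) simp
  also have "\<dots> = (\<Sum>l\<le>n. real (n choose l) * h l)"
    by simp
  also have "\<dots> = - a * Charlier_sum g a n j"
    unfolding Charlier_sum_def sum_distrib_left
    by (rule sum.cong) (auto simp: h_def Suc_diff_le algebra_simps)
  also have "(\<Sum>l\<le>n. real (n choose l) * h (Suc l)) = Charlier_sum g a n (Suc j)"
    unfolding Charlier_sum_def by (rule sum.cong) (auto simp: h_def)
  finally show ?thesis by simp
qed

text \<open>By the hypothesis, multiplication by x acts on \<open>g\<close> as S + N, where N
  multiplies by the index. Since SN - NS = S, moving N past (S - a)^n leaves the extra term n S (S -
  a)^(n-1).\<close>

lemma Charlier_sum_times_x:
  assumes "\<And>j. g (Suc j) = (x - real j) * g j"
  shows "x * Charlier_sum g a n j =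
    Charlier_sum g a n (Suc j) + real j * Charlier_sum g a n j
    + real n * Charlier_sum g a (n - 1) (Suc j)"
proof (induction n arbitrary: j)
  case 0
  then show ?case by (simp add: assms algebra_simps)
next
  case (Suc n)
  have "real n * Charlier_sum g a n (Suc j) =
    real n * (Charlier_sum g a (n - 1) (Suc (Suc j)) - a * Charlier_sum g a (n - 1) (Suc j))"
    by (cases n) (simp_all add: Charlier_sum_Suc)
  moreover have "x * Charlier_sum g a (Suc n) j =
    x * Charlier_sum g a n (Suc j) - a * (x * Charlier_sum g a n j)"
    by (simp add: Charlier_sum_Suc algebra_simps)
  ultimately show ?case
    by (simp add: Suc.IH Charlier_sum_Suc algebra_simps)
qed

text \<open>At position 0, the relation \<open>Charlier_sum_Suc\<close> eliminates the values at
  position 1.\<close>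

lemma Charlier_sum_three_term:
  assumes "\<And>j. g (Suc j) = (x - real j) * g j"
  shows "Charlier_sum g a (Suc n) 0 =
    (x - real n - a) * Charlier_sum g a n 0 - real n * a * Charlier_sum g a (n - 1) 0"
proof -
  have "real n * Charlier_sum g a n 0 =
    real n * (Charlier_sum g a (n - 1) (Suc 0) - a * Charlier_sum g a (n - 1) 0)"
    by (cases n) (simp_all add: Charlier_sum_Suc)
  then show ?thesis
    using Charlier_sum_times_x[OF assms, where n = n and j = 0 and a = a]
    by (simp add: Charlier_sum_Suc algebra_simps)
qed

lemma poly_falling_poly_Suc:
  "poly (falling_poly (Suc j)) x = (x - real j) * poly (falling_poly j) x"
  by (simp add: falling_poly_def algebra_simps)

lemma poly_multiple_Charlier:
  "poly (multiple_Charlier a b m n) x =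
    Charlier_sum (Charlier_sum (\<lambda>j. poly (falling_poly j) x) b n) a m 0"
  by (simp add: multiple_Charlier_def Charlier_sum_def poly_sum sum_distrib_left
      add.commute mult_ac)

lemma poly_multiple_Charlier_0:
  "poly (multiple_Charlier a b 0 n) x = Charlier_sum (\<lambda>j. poly (falling_poly j) x) b n 0"
  by (simp add: poly_multiple_Charlier)

lemma multiple_Charlier_swap: "multiple_Charlier a b m n = multiple_Charlier b a n m"
  unfolding multiple_Charlier_def
  by (subst sum.swap) (simp add: add.commute mult_ac)

text \<open>The operators S - b and (S - a)^m commute.\<close>

lemma Charlier_sum_Charlier_sum_Suc:
  "Charlier_sum (Charlier_sum g b (Suc n)) a m j =
    Charlier_sum (Charlier_sum g b n) a m (Suc j) - b * Charlier_sum (Charlier_sum g b n) a m j"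
proof (induction m arbitrary: j)
  case (Suc m)
  show ?case
    by (simp add: Charlier_sum_Suc[of _ a] Suc algebra_simps)
qed (simp add: Charlier_sum_Suc)

text \<open>This is (S - a) - (S - b) = b - a, applied to the nested sums.\<close>

lemma poly_multiple_Charlier_diff:
  "poly (multiple_Charlier a b (Suc m) n) x =
    poly (multiple_Charlier a b m (Suc n)) x + (b - a) * poly (multiple_Charlier a b m n) x"
  by (simp add: poly_multiple_Charlier Charlier_sum_Charlier_sum_Suc
      Charlier_sum_Suc[of _ a] algebra_simps)

lemma poly_multiple_Charlier_three_term:
  "poly (multiple_Charlier a b 0 (Suc n)) x =
    (x - real n - b) * poly (multiple_Charlier a b 0 n) x
    - real n * b * poly (multiple_Charlier a b 0 (n - 1)) x"
  unfolding poly_multiple_Charlier_0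
  by (rule Charlier_sum_three_term) (rule poly_falling_poly_Suc)

section \<open>The forward difference\<close>

lemma poly_fdiff: "poly (fdiff p) x = poly p (x + 1) - poly p x"
  by (simp add: fdiff_def poly_pcompose add.commute)

lemma fdiff_diff: "fdiff (p - q) = fdiff p - fdiff q"
  by (simp add: poly_eq_poly_eq_iff[symmetric] fun_eq_iff poly_fdiff)

lemma fdiff_smult: "fdiff (smult c p) = smult c (fdiff p)"
  by (simp add: poly_eq_poly_eq_iff[symmetric] fun_eq_iff poly_fdiff algebra_simps)

lemma fdiff_linear_mult: "fdiff ([:c, 1:] * p) = [:c + 1, 1:] * fdiff p + p"
  by (simp add: poly_eq_poly_eq_iff[symmetric] fun_eq_iff poly_fdiff algebra_simps)

section \<open>Orthogonality\<close>

definition orth :: "real measure \<Rightarrow> nat \<Rightarrow> real poly \<Rightarrow> bool" where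
  "orth \<mu> m p \<longleftrightarrow> (\<forall>k<m. (LINT x|\<mu>. poly p x * x ^ k) = 0)"

lemma integrable_poly:
  assumes "borel_finite_moments \<mu>"
  shows "integrable \<mu> (poly p)"
  using assms
  unfolding borel_finite_moments_def poly_altdef[abs_def]
  by (intro Bochner_Integration.integrable_sum integrable_mult_right) auto

lemma integrable_poly_mult_power:
  assumes "borel_finite_moments \<mu>"
  shows "integrable \<mu> (\<lambda>x. poly p x * x ^ k)"
  using integrable_poly[OF assms, of "p * monom 1 k"]
  by (simp add: poly_monom cong: Bochner_Integration.integrable_cong)

lemma orth_diff:
  assumes "borel_finite_moments \<mu>" "orth \<mu> m p" "orth \<mu> m q"
  shows "orth \<mu> m (p - q)"
  using assms integrable_poly_mult_power[OF assms(1)]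
  by (simp add: orth_def left_diff_distrib)

lemma orth_add:
  assumes "borel_finite_moments \<mu>" "orth \<mu> m p" "orth \<mu> m q"
  shows "orth \<mu> m (p + q)"
  using assms integrable_poly_mult_power[OF assms(1)]
  by (simp add: orth_def distrib_right)

lemma orth_smult:
  assumes "orth \<mu> m p"
  shows "orth \<mu> m (smult c p)"
  using assms by (simp add: orth_def mult.assoc)

lemma orth_mono:
  assumes "orth \<mu> m p" "k \<le> m"
  shows "orth \<mu> k p"
  using assms by (auto simp: orth_def)

text \<open>Testing x p against x^k is testing p against x^(k+1), which costs one order of
  orthogonality.\<close>

lemma orth_linear_mult:
  assumes "borel_finite_moments \<mu>" "orth \<mu> (Suc m) p"
  shows "orth \<mu> m ([:c, 1:] * p)"
proof -
  have "orth \<mu> m (pCons 0 p)"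
    unfolding orth_def
  proof (intro allI impI)
    fix k assume "k < m"
    then have "(LINT x|\<mu>. poly p x * x ^ Suc k) = 0"
      using assms(2) unfolding orth_def by blast
    then show "(LINT x|\<mu>. poly (pCons 0 p) x * x ^ k) = 0"
      by (simp add: mult_ac)
  qed
  moreover have "orth \<mu> m (smult c p)"
    using assms(2) by (intro orth_smult) (rule orth_mono, auto)
  ultimately show ?thesis
    using orth_add[OF assms(1)] by simp
qed

section \<open>Consequences of uniqueness for multiple orthogonal polynomials\<close>

locale OPS =
  fixes \<mu>\<^sub>1 \<mu>\<^sub>2 :: "real measure" and P :: "nat \<Rightarrow> nat \<Rightarrow> real poly"
  assumes multiple_OPS: "multiple_OPS \<mu>\<^sub>1 \<mu>\<^sub>2 P"
begin

lemma moments: "borel_finite_moments \<mu>\<^sub>1" "borel_finite_moments \<mu>\<^sub>2"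
  using multiple_OPS by (auto simp: multiple_OPS_def)

lemma monic_orthogonal: "monic_orthogonal \<mu>\<^sub>1 \<mu>\<^sub>2 m n (P m n)"
  using multiple_OPS by (auto simp: multiple_OPS_def)

lemma degree [simp]: "degree (P m n) = m + n"
  using monic_orthogonal by (auto simp: monic_orthogonal_def)

lemma coeff_top [simp]: "coeff (P m n) (m + n) = 1"
  using monic_orthogonal[of m n] by (auto simp: monic_orthogonal_def)

lemma orth1: "orth \<mu>\<^sub>1 m (P m n)" and orth2: "orth \<mu>\<^sub>2 n (P m n)"
  using monic_orthogonal[of m n] by (auto simp: monic_orthogonal_def orth_def)

lemma P_0_0: "P 0 0 = 1"
  by (metis add_0 coeff_top degree degree_0_id one_pCons of_nat_0 one_poly_eq_simps(1))

text \<open>Uniqueness in linear form: adding to \<open>P m n\<close> the part of \<open>p\<close>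
  without its top coefficient gives another monic orthogonal polynomial, so that part
  vanishes.\<close>

lemma eq_smult:
  assumes deg: "degree p \<le> m + n" and orth: "orth \<mu>\<^sub>1 m p" "orth \<mu>\<^sub>2 n p"
  shows "p = smult (coeff p (m + n)) (P m n)"
proof -
  define q where "q = P m n + (p - smult (coeff p (m + n)) (P m n))"
  have top: "coeff q (m + n) = 1"
    by (simp add: q_def)
  moreover have "degree q \<le> m + n"
    unfolding q_def
    by (intro degree_add_le degree_diff_le) (auto simp: deg degree_smult_le[THEN order_trans])
  ultimately have "degree q = m + n"
    by (intro antisym) (simp_all add: le_degree)
  moreover have "orth \<mu>\<^sub>1 m q" "orth \<mu>\<^sub>2 n q"
    unfolding q_def
    by (intro orth_add orth_diff orth_smult moments orth orth1 orth2)+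
  ultimately have "monic_orthogonal \<mu>\<^sub>1 \<mu>\<^sub>2 m n q"
    using top by (simp add: monic_orthogonal_def orth_def)
  then have "q = P m n"
    using multiple_OPS by (auto simp: multiple_OPS_def)
  then show ?thesis
    by (simp add: q_def)
qed

text \<open>The leading terms cancel, and the difference keeps the orthogonality common to both
  polynomials, so \<open>eq_smult\<close> applies.\<close>

lemma nearest_neighbour_diff: "\<exists>k. P (Suc m) n - P m (Suc n) = smult k (P m n)"
proof -
  let ?p = "P (Suc m) n - P m (Suc n)"
  have le: "degree ?p \<le> Suc (m + n)"
    by (intro degree_diff_le) auto
  have "coeff ?p (Suc (m + n)) = 0"
    using coeff_top[of "Suc m" n] coeff_top[of m "Suc n"] by simp
  then have "degree ?p \<le> m + n"
    using le by (metis Suc_leI le_neq_implies_less leading_coeff_0_iff degree_0 less_Suc_eq_le zero_le)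
  moreover have "orth \<mu>\<^sub>1 m ?p" "orth \<mu>\<^sub>2 n ?p"
    using orth1[of "Suc m" n] orth2[of "Suc n" m]
    by (auto intro!: orth_diff moments orth1 orth2 elim: orth_mono)
  ultimately show ?thesis
    using eq_smult by blast
qed

lemma three_term:
  "\<exists>\<alpha> \<beta>. P 0 (Suc (Suc n)) = [:\<alpha>, 1:] * P 0 (Suc n) - smult \<beta> (P 0 n)"
proof -
  define q where "q = P 0 (Suc (Suc n)) - [:0, 1:] * P 0 (Suc n)"
  \<comment> \<open>The degree n + 2 terms cancel in \<open>q\<close>; subtracting this multiple of
    \<open>P 0 (Suc n)\<close> removes degree n + 1 as well.\<close>
  define \<alpha> where "\<alpha> = coeff q (Suc n)"
  define p where "p = q - smult \<alpha> (P 0 (Suc n))"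
  have p_eq: "p = P 0 (Suc (Suc n)) - [:\<alpha>, 1:] * P 0 (Suc n)"
    by (simp add: p_def q_def)
  have "degree p \<le> n"
  proof (rule degree_le, intro allI impI)
    fix i assume "n < i"
    then consider "i = Suc n" | "i = Suc (Suc n)" | "i > Suc (Suc n)"
      by linarith
    then show "coeff p i = 0"
    proof cases
      case 1
      then show ?thesis using coeff_top[of 0 "Suc n"] by (simp add: p_def \<alpha>_def)
    next
      case 2
      then show ?thesis
        using coeff_top[of 0 "Suc n"] coeff_top[of 0 "Suc (Suc n)"]
        by (simp add: p_def q_def coeff_eq_0)
    next
      case 3
      then show ?thesis
        by (cases i) (simp_all add: p_def q_def coeff_eq_0)
    qed
  qed
  moreover have "orth \<mu>\<^sub>2 n p"
    unfolding p_eq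
    using orth2[of "Suc (Suc n)" 0] orth2[of "Suc n" 0]
    by (intro orth_diff orth_linear_mult moments) (auto elim: orth_mono)
  ultimately have "p = smult (coeff p n) (P 0 n)"
    using eq_smult[of p 0 n] by (simp add: orth_def)
  moreover have "P 0 (Suc (Suc n)) = [:\<alpha>, 1:] * P 0 (Suc n) + p"
    unfolding p_eq by simp
  ultimately have "P 0 (Suc (Suc n)) = [:\<alpha>, 1:] * P 0 (Suc n) - smult (- coeff p n) (P 0 n)"
    by (metis diff_minus_eq_add smult_minus_left)
  then show ?thesis by blast
qed

text \<open>Integrating the recurrence shows that the squared norm of \<open>P 0 1\<close> is f
  times the total mass of the second measure.\<close>

lemma recurrence_coeff_pos:
  assumes rec: "\<And>x. poly (P 0 2) x = (x - b) * poly (P 0 1) x - f"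
  shows "f > 0"
proof -
  define q where "q = P 0 1"
  let ?q = "poly q"
  have int_q: "integrable \<mu>\<^sub>2 ?q" and int_qx: "integrable \<mu>\<^sub>2 (\<lambda>x. ?q x * x)"
    using integrable_poly[OF moments(2)] integrable_poly_mult_power[OF moments(2), of _ 1]
    by simp_all
  have int_c: "integrable \<mu>\<^sub>2 (\<lambda>x. k)" for k :: real
    using integrable_poly_mult_power[OF moments(2), of "[:k:]" 0] by simp
  have q0: "(LINT x|\<mu>\<^sub>2. ?q x) = 0" and p0: "(LINT x|\<mu>\<^sub>2. poly (P 0 2) x) = 0"
    using orth2[of 1 0] orth2[of 2 0] by (auto simp: orth_def q_def dest!: spec[of _ 0])
  have "0 = (LINT x|\<mu>\<^sub>2. (?q x * x - b * ?q x) - f)"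
    using p0 by (simp add: rec q_def algebra_simps)
  also have "\<dots> = (LINT x|\<mu>\<^sub>2. ?q x * x) - b * (LINT x|\<mu>\<^sub>2. ?q x) - f * (LINT x|\<mu>\<^sub>2. 1)"
    using int_q int_qx int_c by simp
  finally have A: "(LINT x|\<mu>\<^sub>2. ?q x * x) = f * (LINT x|\<mu>\<^sub>2. 1)"
    using q0 by simp
  have q_eq: "?q x = x + coeff q 0" for x
    using coeff_top[of 0 1] degree[of 0 1] unfolding q_def[symmetric] by (simp add: poly_altdef)
  have sq: "(?q x)\<^sup>2 = ?q x * x + coeff q 0 * ?q x" for x
    by (simp add: q_eq power2_eq_square algebra_simps)
  have int_sq: "integrable \<mu>\<^sub>2 (\<lambda>x. (?q x)\<^sup>2)"
    unfolding sq using int_q int_qx by simp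
  have B: "(LINT x|\<mu>\<^sub>2. (?q x)\<^sup>2) = f * (LINT x|\<mu>\<^sub>2. 1)"
    unfolding sq using int_q int_qx q0 A by simp
  have "(LINT x|\<mu>\<^sub>2. (?q x)\<^sup>2) \<noteq> 0"
  proof
    assume "(LINT x|\<mu>\<^sub>2. (?q x)\<^sup>2) = 0"
    then have "AE x in \<mu>\<^sub>2. ?q x = 0"
      using integral_nonneg_eq_0_iff_AE[OF int_sq] by simp
    then have "(LINT x|\<mu>\<^sub>2. ?q x * x ^ k) = 0" for k
      by (intro integral_eq_zero_AE) auto
    \<comment> \<open>Vanishing almost everywhere, \<open>q\<close> meets the conditions at index
      (0, 2), but it has degree 1, so the factor is 0.\<close>
    then have "q = smult (coeff q (0 + 2)) (P 0 2)"
      by (intro eq_smult) (auto simp: orth_def q_def)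
    then have "q = 0"
      by (simp add: coeff_eq_0 q_def)
    then show False
      using degree[of 0 1] by (simp add: q_def)
  qed
  then have "(LINT x|\<mu>\<^sub>2. (?q x)\<^sup>2) > 0"
    by (simp add: order_less_le)
  moreover have "(LINT x|\<mu>\<^sub>2. (1::real)) \<ge> 0"
    by simp
  ultimately show ?thesis
    unfolding B by (simp add: zero_less_mult_iff)
qed

end

lemma multiple_OPS_swap:
  assumes "multiple_OPS \<mu>\<^sub>1 \<mu>\<^sub>2 P"
  shows "multiple_OPS \<mu>\<^sub>2 \<mu>\<^sub>1 (\<lambda>m n. P n m)"
proof -
  have "monic_orthogonal \<mu>\<^sub>2 \<mu>\<^sub>1 m n q \<longleftrightarrow> monic_orthogonal \<mu>\<^sub>1 \<mu>\<^sub>2 n m q" for m n q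
    by (auto simp: monic_orthogonal_def add.commute)
  then show ?thesis
    using assms by (simp add: multiple_OPS_def)
qed

section \<open>Orthogonal Appell sequences\<close>

locale Appell_OPS = OPS +
  assumes Appell: "multiple_Delta_Appell P"
begin

lemma fdiff_P: "fdiff (P m n) = smult (real m) (P (m - 1) n) + smult (real n) (P m (n - 1))"
  using Appell by (simp add: multiple_Delta_Appell_def)

text \<open>The coefficient of degree m + n - 1 is m + n. This allows scalar factors to be compared
  after differencing.\<close>

lemma fdiff_P_nonzero:
  assumes "m + n \<noteq> 0"
  shows "fdiff (P m n) \<noteq> 0"
proof
  assume "fdiff (P m n) = 0"
  then have "real m * coeff (P (m - 1) n) (m + n - 1) + real n * coeff (P m (n - 1)) (m + n - 1) = 0"
    unfolding fdiff_P by (metis coeff_0 coeff_add coeff_smult)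
  moreover have "real m * coeff (P (m - 1) n) (m + n - 1) = real m"
    using coeff_top[of "m - 1" n] by (cases m) simp_all
  moreover have "real n * coeff (P m (n - 1)) (m + n - 1) = real n"
    using coeff_top[of m "n - 1"] by (cases n) simp_all
  ultimately have "real m + real n = 0"
    by linarith
  then show False
    using assms by simp
qed

lemma nearest_neighbour_diff_const:
  "\<exists>\<kappa>. \<forall>m n. P (Suc m) n - P m (Suc n) = smult \<kappa> (P m n)"
proof -
  obtain k where k: "\<And>m n. P (Suc m) n - P m (Suc n) = smult (k m n) (P m n)"
    using nearest_neighbour_diff by metis
  have "k m n = k 0 0" for m n
  proof (induction "m + n" arbitrary: m n)
    case 0
    then show ?case by simp
  next
    case (Suc s)
    \<comment> \<open>The factor m covers the case m = 0, where the truncated index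
      \<open>m - 1\<close> would be wrong; likewise for n below.\<close>
    have m: "smult (real m) (P m n - P (m - 1) (Suc n)) = smult (real m) (smult (k 0 0) (P (m - 1) n))"
      using k[of "m - 1" n] Suc by (cases m) auto
    have n: "smult (real n) (P (Suc m) (n - 1) - P m n) = smult (real n) (smult (k 0 0) (P m (n - 1)))"
      using k[of m "n - 1"] Suc by (cases n) auto
    have "smult (k m n) (fdiff (P m n)) = fdiff (P (Suc m) n - P m (Suc n))"
      by (simp add: k fdiff_smult)
    \<comment> \<open>The coefficient of \<open>P m n\<close> is (m + 1) - (n + 1) = m - n, split
      between the two brackets.\<close>
    also have "\<dots> = smult (real m) (P m n - P (m - 1) (Suc n)) + smult (real n) (P (Suc m) (n - 1) - P m n)"
      by (simp add: fdiff_diff fdiff_P algebra_simps smult_add_left smult_diff_right)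
    also have "\<dots> = smult (k 0 0) (fdiff (P m n))"
      unfolding m n by (simp add: fdiff_P smult_add_right mult.commute)
    finally have "smult (k m n - k 0 0) (fdiff (P m n)) = 0"
      by (simp add: smult_diff_left)
    moreover have "fdiff (P m n) \<noteq> 0"
      by (rule fdiff_P_nonzero) (simp flip: Suc.hyps(2))
    ultimately show ?case
      by simp
  qed
  then show ?thesis using k by metis
qed

text \<open>Differencing the recurrence for \<open>P 0 (n + 2)\<close> yields a second recurrence
  for \<open>P 0 (n + 1)\<close>; comparing it with the induction hypothesis determines both
  coefficients.\<close>

lemma edge_recurrence:
  "\<exists>e f. \<forall>n. P 0 (Suc n) = [:- e - real n, 1:] * P 0 n - smult (real n * f) (P 0 (n - 1))"
proof -
  obtain \<alpha> \<beta> where rec: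
    "\<And>n. P 0 (Suc (Suc n)) = [:\<alpha> n, 1:] * P 0 (Suc n) - smult (\<beta> n) (P 0 n)"
    using three_term by metis
  have fd: "fdiff (P 0 (Suc n)) = smult (real (Suc n)) (P 0 n)" for n
    using fdiff_P[of 0 "Suc n"] by simp
  define e where "e = - coeff (P 0 1) 0"
  define f where "f = \<beta> 0"
  have P1: "P 0 (Suc 0) = [:- e, 1:]"
    using coeff_top[of 0 1]
    by (intro poly_eqI) (auto simp: e_def coeff_pCons coeff_eq_0 split: nat.split)
  have "\<alpha> 0 = - e - 1"
  proof -
    have "fdiff (P 0 (Suc (Suc 0))) = [:\<alpha> 0 + 1, 1:] * fdiff (P 0 (Suc 0)) + P 0 (Suc 0)
      - smult (\<beta> 0) (fdiff (P 0 0))"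
      by (simp only: rec fdiff_diff fdiff_linear_mult fdiff_smult)
    moreover have "fdiff [:- e, 1:] = 1"
      using fd[of 0] by (simp add: P1 P_0_0)
    ultimately show ?thesis
      using fdiff_P[of 0 0] by (simp add: fd P_0_0 P1 one_pCons)
  qed
  then have rec1: "P 0 (Suc (Suc 0)) = [:- e - 1, 1:] * P 0 (Suc 0) - smult f (P 0 0)"
    using rec[of 0] by (simp add: f_def)
  have "P 0 (Suc n) = [:- e - real n, 1:] * P 0 n - smult (real n * f) (P 0 (n - 1))" for n
  proof (induction n)
    case 0
    then show ?case by (simp add: P_0_0 P1)
  next
    case (Suc n)
    show ?case
    \<comment> \<open>For n = 0 differencing says nothing about \<open>\<beta> 0\<close>, since
      \<open>P 0 0\<close> is constant; this is the free parameter f.\<close>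
    proof (cases n)
      case 0
      then show ?thesis using rec1 by simp
    next
      case n: (Suc k)
      have "fdiff (P 0 (Suc (Suc n))) = [:\<alpha> n + 1, 1:] * fdiff (P 0 (Suc n)) + P 0 (Suc n)
        - smult (\<beta> n) (fdiff (P 0 n))"
        by (simp only: rec[of n] fdiff_diff fdiff_linear_mult fdiff_smult)
      then have lincomb: "smult (real (Suc (Suc n))) (P 0 (Suc n)) =
        [:\<alpha> n + 1, 1:] * smult (real (Suc n)) (P 0 n) + P 0 (Suc n)
        - smult (\<beta> n) (smult (real n) (P 0 (n - 1)))"
        using fd[of k] by (simp only: fd n diff_Suc_1)
      have eq: "smult (real (Suc n)) (P 0 (Suc n)) =
        smult (real (Suc n)) ([:\<alpha> n + 1, 1:] * P 0 n) - smult (\<beta> n * real n) (P 0 (n - 1))"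
        (is "?l = ?r")
      proof (rule poly_eqI)
        fix i
        show "coeff ?l i = coeff ?r i"
          using arg_cong[OF lincomb, of "\<lambda>p. coeff p i"] by (cases i) (simp_all add: algebra_simps)
      qed
      have ab: "smult (real (Suc n) * (\<alpha> n + 1 + e + real n)) (P 0 n) =
        smult (real n * (\<beta> n - real (Suc n) * f)) (P 0 (n - 1))"
        (is "smult ?a _ = smult ?b _")
      proof (rule poly_eqI)
        fix i
        show "coeff (smult ?a (P 0 n)) i = coeff (smult ?b (P 0 (n - 1))) i"
          using arg_cong[OF eq, of "\<lambda>p. coeff p i"] unfolding Suc.IH
          by (cases i) (simp_all add: algebra_simps)
      qed
      \<comment> \<open>The two sides of \<open>ab\<close> have polynomials of degrees n and n - 1,
        so both factors vanish.\<close>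
      have "?a = coeff (smult ?a (P 0 n)) n"
        using coeff_top[of 0 n] by simp
      also have "\<dots> = 0"
        unfolding ab using n by (simp add: coeff_eq_0)
      finally have a: "?a = 0" .
      then have "?b * coeff (P 0 (n - 1)) (n - 1) = 0"
        using ab by (metis coeff_0 coeff_smult smult_0_left)
      then have "\<beta> n = real (Suc n) * f"
        using coeff_top[of 0 "n - 1"] n by simp
      moreover have "\<alpha> n = - e - real (Suc n)"
        using a by (simp add: add_eq_0_iff)
      ultimately show ?thesis
        using rec[of n] by simp
    qed
  qed
  then show ?thesis by blast
qed

text \<open>The first parameter does not affect the edge m = 0; it stays universally quantified so
  that it can be chosen later from \<kappa>.\<close>

lemma edge_Charlier:
  "\<exists>f c. \<forall>a n x. poly (P 0 n) x = poly (multiple_Charlier a f 0 n) (x - c)"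
proof -
  obtain e f where rec:
    "\<And>n. P 0 (Suc n) = [:- e - real n, 1:] * P 0 n - smult (real n * f) (P 0 (n - 1))"
    using edge_recurrence by blast
  \<comment> \<open>The translation solves x - e - n = (x - c) - n - f for c.\<close>
  have "poly (P 0 n) x = poly (multiple_Charlier a f 0 n) (x - (e - f))" for a n x
  proof (induction n rule: less_induct)
    case (less n)
    show ?case
    proof (cases n)
      case 0
      then show ?thesis
        by (simp add: P_0_0 multiple_Charlier_def falling_poly_def)
    next
      case (Suc k)
      have "poly (P 0 k) x = poly (multiple_Charlier a f 0 k) (x - (e - f))"
        "poly (P 0 (k - 1)) x = poly (multiple_Charlier a f 0 (k - 1)) (x - (e - f))"
        using Suc by (auto intro!: less)
      then show ?thesis
        unfolding Suc rec poly_multiple_Charlier_three_term by (simp add: algebra_simps)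
    qed
  qed
  then show ?thesis by blast
qed

lemma Charlier:
  "\<exists>a b c. \<forall>m n x. poly (P m n) x = poly (multiple_Charlier a b m n) (x - c)"
proof -
  obtain \<kappa> where \<kappa>: "\<And>m n. P (Suc m) n - P m (Suc n) = smult \<kappa> (P m n)"
    using nearest_neighbour_diff_const by blast
  obtain b c where edge: "\<And>a n x. poly (P 0 n) x = poly (multiple_Charlier a b 0 n) (x - c)"
    using edge_Charlier by blast
  \<comment> \<open>The first parameter is chosen so that the Charlier difference constant, second
    minus first parameter, equals \<kappa>.\<close>
  have "poly (P m n) x = poly (multiple_Charlier (b - \<kappa>) b m n) (x - c)" for m n x
  proof (induction m arbitrary: n)
    case 0
    then show ?case by (rule edge)
  next
    case (Suc m)
    have "P (Suc m) n = P m (Suc n) + smult \<kappa> (P m n)"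
      using \<kappa>[of m n] by (simp add: algebra_simps)
    then show ?case
      by (simp add: Suc poly_multiple_Charlier_diff)
  qed
  then show ?thesis by blast
qed

end

section \<open>Positivity of the parameters\<close>

lemma (in OPS) Charlier_parameter_pos:
  assumes "\<And>n x. poly (P 0 n) x = poly (multiple_Charlier a b 0 n) (x - c)"
  shows "b > 0"
proof (rule recurrence_coeff_pos)
  fix x
  have "poly (multiple_Charlier a b 0 0) (x - c) = 1"
    using assms[of 0 x] by (simp add: P_0_0)
  then show "poly (P 0 2) x = (x - (c + 1 + b)) * poly (P 0 1) x - b"
    using poly_multiple_Charlier_three_term[of a b 1 "x - c"]
    by (simp add: assms numeral_2_eq_2 algebra_simps)
qed

theorem theorem15:
  fixes P :: "nat \<Rightarrow> nat \<Rightarrow> real poly" and \<mu>\<^sub>1 \<mu>\<^sub>2 :: "real measure"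
  assumes "multiple_OPS \<mu>\<^sub>1 \<mu>\<^sub>2 P"
    and "multiple_Delta_Appell P"
  shows "\<exists>a\<^sub>1 a\<^sub>2 c. a\<^sub>1 > 0 \<and> a\<^sub>2 > 0 \<and>
    (\<forall>m n x. poly (P m n) x = poly (multiple_Charlier a\<^sub>1 a\<^sub>2 m n) (x - c))"
proof -
  interpret Appell_OPS \<mu>\<^sub>1 \<mu>\<^sub>2 P
    by unfold_locales (fact assms)+
  interpret swap: OPS \<mu>\<^sub>2 \<mu>\<^sub>1 "\<lambda>m n. P n m"
    by unfold_locales (rule multiple_OPS_swap, fact)
  obtain a b c where eq:
    "\<And>m n x. poly (P m n) x = poly (multiple_Charlier a b m n) (x - c)"
    using Charlier by blast
  have "b > 0"
    by (rule Charlier_parameter_pos) (rule eq)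
  moreover have "a > 0"
    \<comment> \<open>Exchanging the measures turns the edge \<open>P m 0\<close> into the edge
      treated before and swaps the parameters.\<close>
    by (rule swap.Charlier_parameter_pos) (simp add: eq multiple_Charlier_swap[of a b])
  ultimately show ?thesis
    using eq by blast
qed

end
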